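(* Let $\Omega\subseteq\mathbb{R}^n$ be a closed convex set, $\theta:\mathbb{R}^n\to\mathbb{R}$ a closed proper convex function, and $F:\mathbb{R}^n\to\mathbb{R}^n$ a monotone mapping. Let $\Omega^*$ be the set of solutions of the mixed variational inequality problem: find $w^*\in\Omega$ such that $$\theta(w)-\theta(w^* )+\langle w-w^*,F(w^* )\rangle\ge 0\quad\text{for all } w\in\Omega .$$ Let $G\in S^n_+$ and assume: (i) $\Omega^*$ is nonempty; (ii) $F$ is $H$-monotone for some $H\in S^n_+$, i.e. $\langle u-v,F(u)-F(v)\rangle\ge\|u-v\|_H^2$ for all $u,v\in\mathbb{R}^n$; (iii) $M:=G+H\in S^n_{++}$. Let $\{\alpha_k\}_{k=0}^\infty$ and $\{\lambda_k\}_{k=0}^\infty$ be sequences of real numbers such that, for all $k$, $0\le\alpha_k\le\alpha$ for some $\alpha\in[0,1)$ and $\lambda_k\ge\lambda$ for some $\lambda>0$ (with $\alpha,\lambda$ independent of $k$). Let $\{w^k\}_{k=0}^\infty\subseteq\mathbb{R}^n$ be a sequence generated by the general inertial proximal point method with these data (defined in the context). If $$\sum_{k=1}^\infty\alpha_k\|w^k-w^{k-1}\|_G^2<\infty,$$ then the sequence $\{w^k\}_{k=0}^\infty$ converges to some point in $\Omega^*$ as $k\to\infty$.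
   Context: $S^n_+$ and $S^n_{++}$ denote the sets of symmetric positive semidefinite and symmetric positive definite real $n\times n$ matrices. For $A\in S^n_+$ and $u,v\in\mathbb{R}^n$, $\langle u,v\rangle_A:=u^TAv$ and $\|u\|_A:=\sqrt{\langle u,u\rangle_A}$. $\langle\cdot,\cdot\rangle$ is the standard inner product. General inertial proximal point method: given any $w^0=w^{-1}\in\mathbb{R}^n$, for $k=0,1,2,\dots$ set $$\bar w^k:=w^k+\alpha_k(w^k-w^{k-1}),$$ and find $w^{k+1}\in\Omega$ such that $$\theta(w)-\theta(w^{k+1})+\big\langle w-w^{k+1},\,F(w^{k+1})+\lambda_k^{-1}G(w^{k+1}-\bar w^k)\big\rangle\ge0\quad\text{for all } w\in\Omega .$$
   Formalization: The formal theorem additionally assumes that the method can be run from every starting point w^0 (all subproblems along some run are solvable), automatic for continuous F; without this the claim fails for some discontinuous monotone F. *)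

theory Defs
  imports "HOL-Analysis.Analysis"
begin

definition sym_psd :: "real^'n^'n \<Rightarrow> bool" where
  "sym_psd A \<longleftrightarrow> transpose A = A \<and> (\<forall>u. 0 \<le> u \<bullet> (A *v u))"

definition sym_pd :: "real^'n^'n \<Rightarrow> bool" where
  "sym_pd A \<longleftrightarrow> transpose A = A \<and> (\<forall>u. u \<noteq> 0 \<longrightarrow> 0 < u \<bullet> (A *v u))"

definition inner_mat :: "real^'n^'n \<Rightarrow> real^'n \<Rightarrow> real^'n \<Rightarrow> real" where
  "inner_mat A u v = u \<bullet> (A *v v)"

definition norm_mat :: "real^'n^'n \<Rightarrow> real^'n \<Rightarrow> real" where
  "norm_mat A u = sqrt (inner_mat A u u)"

definition monotone_mapping :: "(real^'n \<Rightarrow> real^'n) \<Rightarrow> bool" where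
  "monotone_mapping F \<longleftrightarrow> (\<forall>u v. 0 \<le> (u - v) \<bullet> (F u - F v))"

definition mat_monotone :: "real^'n^'n \<Rightarrow> (real^'n \<Rightarrow> real^'n) \<Rightarrow> bool" where
  "mat_monotone H F \<longleftrightarrow> (\<forall>u v. (norm_mat H (u - v))\<^sup>2 \<le> (u - v) \<bullet> (F u - F v))"

(* Convex with closed epigraph. Properness is automatic, because the function is
   real-valued on the whole space. *)
definition closed_proper_convex :: "(real^'n \<Rightarrow> real) \<Rightarrow> bool" where
  "closed_proper_convex \<theta> \<longleftrightarrow> convex_on UNIV \<theta> \<and> closed (epigraph UNIV \<theta>)"

definition mvi_solutions ::
  "(real^'n) set \<Rightarrow> (real^'n \<Rightarrow> real) \<Rightarrow> (real^'n \<Rightarrow> real^'n) \<Rightarrow> (real^'n) set" where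
  "mvi_solutions \<Omega> \<theta> F =
     {x \<in> \<Omega>. \<forall>w\<in>\<Omega>. 0 \<le> \<theta> w - \<theta> x + (w - x) \<bullet> F x}"

(* For k = 0 the truncated subtraction gives w (k - 1) = w 0, which is exactly the
   convention that the point with index -1 coincides with the starting point. *)
definition inertial_point :: "(nat \<Rightarrow> real) \<Rightarrow> (nat \<Rightarrow> real^'n) \<Rightarrow> nat \<Rightarrow> real^'n" where
  "inertial_point \<alpha> w k = w k + \<alpha> k *\<^sub>R (w k - w (k - 1))"

definition inertial_ppm ::
  "(real^'n) set \<Rightarrow> (real^'n \<Rightarrow> real) \<Rightarrow> (real^'n \<Rightarrow> real^'n) \<Rightarrow> real^'n^'n \<Rightarrow>
   (nat \<Rightarrow> real) \<Rightarrow> (nat \<Rightarrow> real) \<Rightarrow> (nat \<Rightarrow> real^'n) \<Rightarrow> bool" where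
  "inertial_ppm \<Omega> \<theta> F G \<alpha> lam w \<longleftrightarrow>
     (\<forall>k. w (Suc k) \<in> \<Omega> \<and>
       (\<forall>x\<in>\<Omega>. 0 \<le> \<theta> x - \<theta> (w (Suc k)) +
          (x - w (Suc k)) \<bullet>
            (F (w (Suc k)) + inverse (lam k) *\<^sub>R (G *v (w (Suc k) - inertial_point \<alpha> w k)))))"

(* The method can be run from any given starting point. This holds whenever F is
   continuous (and G + H is positive definite), but monotonicity alone does not imply it.
   Without it a generated sequence may converge to a point that is not a solution:
   on the real line with theta = 0, G = 1, H = 0, alpha_k = 1/2, lambda_k = 4, let
   F y = y for y \<le> 0, F y = 0 for 0 < y < 2 and F y = 1 for y \<ge> 2. The sequence
   w_0 = -10/3, w_k = 2 - (8/3) (1/2)^(k-1) for k \<ge> 1 is generated by the method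
   and converges to 2, but the solution set is [0,2). *)
definition inertial_ppm_well_defined ::
  "(real^'n) set \<Rightarrow> (real^'n \<Rightarrow> real) \<Rightarrow> (real^'n \<Rightarrow> real^'n) \<Rightarrow> real^'n^'n \<Rightarrow>
   (nat \<Rightarrow> real) \<Rightarrow> (nat \<Rightarrow> real) \<Rightarrow> bool" where
  "inertial_ppm_well_defined \<Omega> \<theta> F G \<alpha> lam \<longleftrightarrow>
     (\<forall>w0. \<exists>w. w 0 = w0 \<and> inertial_ppm \<Omega> \<theta> F G \<alpha> lam w)"

end

theory Submission
  imports Defs
begin

text \<open>
  For a solution \<open>x\<close>, monotonicity turns the iteration into
  \<open>\<phi> (k + 1) - \<phi> k \<le> \<alpha> k (\<phi> k - \<phi> (k - 1)) + \<delta> k - \<epsilon> k\<close>, where \<open>\<phi> k\<close> is the squared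
  \<open>G\<close>-distance of \<open>w k\<close> to \<open>x\<close>, \<open>\<delta>\<close> is summable, and \<open>\<epsilon> k\<close> collects the squared \<open>G\<close>-residual and
  the squared \<open>H\<close>-distance of \<open>w (k + 1)\<close> to \<open>x\<close>.  Since \<open>\<alpha> k\<close> stays away from 1, \<open>\<phi>\<close> converges
  and \<open>\<epsilon>\<close> is summable, so \<open>w\<close> is bounded because \<open>G + H\<close> is positive definite.  A cluster point
  \<open>y\<close> of \<open>w\<close> is a solution: the first step of the method started at \<open>y\<close> yields a point \<open>p\<close>, and
  comparing \<open>p\<close> with the iterates forces \<open>p = y\<close>.  Taking \<open>x = y\<close> above gives the convergence of
  the whole sequence.
\<close>

section \<open>Bilinear forms given by matrices\<close>

lemma inner_mat_simps:
  "inner_mat A (u + v) x = inner_mat A u x + inner_mat A v x"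
  "inner_mat A x (u + v) = inner_mat A x u + inner_mat A x v"
  "inner_mat A (u - v) x = inner_mat A u x - inner_mat A v x"
  "inner_mat A x (u - v) = inner_mat A x u - inner_mat A x v"
  "inner_mat A (c *\<^sub>R u) x = c * inner_mat A u x"
  "inner_mat A x (c *\<^sub>R u) = c * inner_mat A x u"
  by (simp_all add: inner_mat_def inner_add_left inner_add_right inner_diff_left inner_diff_right
      matrix_vector_right_distrib matrix_vector_mult_diff_distrib matrix_vector_mult_scaleR)

lemma inner_mat_add: "inner_mat (A + B) u v = inner_mat A u v + inner_mat B u v"
  by (simp add: inner_mat_def matrix_vector_mult_add_rdistrib inner_add_right)

lemma inner_mat_commute: "transpose A = A \<Longrightarrow> inner_mat A u v = inner_mat A v u"
  unfolding inner_mat_def by (metis dot_lmul_matrix inner_commute transpose_matrix_vector)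

lemma sym_psdD:
  assumes "sym_psd A"
  shows "transpose A = A" "0 \<le> inner_mat A u u"
  using assms by (auto simp: sym_psd_def inner_mat_def)

lemma norm_mat_power2: "sym_psd A \<Longrightarrow> (norm_mat A u)\<^sup>2 = inner_mat A u u"
  by (simp add: norm_mat_def sym_psdD)

lemma tendsto_inner_mat:
  assumes "(f \<longlongrightarrow> x) L" "(g \<longlongrightarrow> y) L"
  shows "((\<lambda>k. inner_mat A (f k) (g k)) \<longlongrightarrow> inner_mat A x y) L"
  unfolding inner_mat_def using assms
  by (intro tendsto_inner bounded_linear.tendsto[OF matrix_vector_mul_bounded_linear])

text \<open>The form at \<open>u + s *\<^sub>R v\<close> is a polynomial in \<open>s\<close> of
  degree at most two that is never negative. As \<open>A\<close> may be singular, its leading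
  coefficient can vanish.\<close>

lemma inner_mat_Cauchy_Schwarz:
  assumes "sym_psd A"
  shows "(inner_mat A u v)\<^sup>2 \<le> inner_mat A u u * inner_mat A v v"
proof -
  define a b c where "a = inner_mat A u u" and "b = inner_mat A u v" and "c = inner_mat A v v"
  have quad: "0 \<le> a + 2 * s * b + s\<^sup>2 * c" for s
  proof -
    have "inner_mat A (u + s *\<^sub>R v) (u + s *\<^sub>R v) = a + 2 * s * b + s\<^sup>2 * c"
      using inner_mat_commute[OF sym_psdD(1)[OF assms], of v u]
      by (simp add: inner_mat_simps a_def b_def c_def power2_eq_square algebra_simps)
    then show ?thesis using sym_psdD(2)[OF assms] by metis
  qed
  have "0 \<le> c" unfolding c_def by (rule sym_psdD(2)[OF assms])
  show ?thesis
  proof (cases "c = 0")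
    case True
    have "b = 0"
    proof (rule ccontr)
      assume "b \<noteq> 0"
      \<comment> \<open>This choice of \<open>s\<close> makes \<open>a + 2 * s * b\<close> equal to
        -1.\<close>
      then show False using quad[of "- (a + 1) / (2 * b)"] True by (simp add: field_simps)
    qed
    then show ?thesis using True unfolding a_def b_def c_def by simp
  next
    case False
    then have "0 < c" using \<open>0 \<le> c\<close> by simp
    \<comment> \<open>\<open>- b / c\<close> minimises the quadratic.\<close>
    have "0 \<le> a - b\<^sup>2 / c"
      using quad[of "- b / c"] \<open>0 < c\<close> by (simp add: field_simps power2_eq_square)
    then show ?thesis using \<open>0 < c\<close> unfolding a_def b_def c_def by (simp add: field_simps)
  qed
qed

text \<open>The form attains a minimum on the compact unit sphere, positive by definiteness;
  homogeneity of degree two carries the bound to all vectors.\<close>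

lemma sym_pd_coercive:
  fixes A :: "real^'n^'n"
  assumes "sym_pd A"
  obtains c where "0 < c" "\<And>v. c * (norm v)\<^sup>2 \<le> inner_mat A v v"
proof -
  let ?S = "sphere (0 :: real^'n) 1"
  have "continuous_on ?S (\<lambda>v. inner_mat A v v)"
    unfolding continuous_on_def by (intro ballI tendsto_inner_mat tendsto_ident_at)
  moreover have "?S \<noteq> {}"
    by simp
  ultimately obtain m where m: "m \<in> ?S" "\<And>v. v \<in> ?S \<Longrightarrow> inner_mat A m m \<le> inner_mat A v v"
    using continuous_attains_inf[OF compact_sphere] by blast
  have "m \<noteq> 0" using m(1) by auto
  then have pos: "0 < inner_mat A m m" using assms by (simp add: sym_pd_def inner_mat_def)
  have "inner_mat A m m * (norm v)\<^sup>2 \<le> inner_mat A v v" for v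
  proof (cases "v = 0")
    case True
    then show ?thesis by (simp add: inner_mat_def)
  next
    case False
    let ?u = "(1 / norm v) *\<^sub>R v"
    have "inner_mat A m m \<le> inner_mat A ?u ?u" using m(2) False by simp
    then show ?thesis
      using False by (simp add: inner_mat_simps field_simps power2_eq_square)
  qed
  with pos show ?thesis by (rule that)
qed

section \<open>Scalar inertial recurrences\<close>

text \<open>The positive parts of the increments of \<phi> contract by the factor \<open>a\<close>
  up to \<delta>, hence are summable. So \<phi> has finite total increase and is bounded below,
  which gives convergence; summing the recurrence then bounds the partial sums of
  \<epsilon>.\<close>

lemma inertial_recurrence_converges:
  fixes \<phi> \<delta> \<epsilon> \<alpha> :: "nat \<Rightarrow> real"
  assumes rec: "\<And>k. \<phi> (Suc k) - \<phi> k \<le> \<alpha> k * (\<phi> k - \<phi> (k - 1)) + \<delta> k - \<epsilon> k"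
    and \<alpha>: "\<And>k. 0 \<le> \<alpha> k" "\<And>k. \<alpha> k \<le> a" and a: "0 \<le> a" "a < 1"
    and \<phi>: "\<And>k. 0 \<le> \<phi> k" and \<delta>: "\<And>k. 0 \<le> \<delta> k" "summable \<delta>" and \<epsilon>: "\<And>k. 0 \<le> \<epsilon> k"
  shows "convergent \<phi>" "summable \<epsilon>"
proof -
  define p where "p k = max 0 (\<phi> k - \<phi> (k - 1))" for k
  have p_nonneg: "0 \<le> p k" for k by (simp add: p_def)
  have \<alpha>p: "\<alpha> k * (\<phi> k - \<phi> (k - 1)) \<le> a * p k" for k
  proof -
    have "\<alpha> k * (\<phi> k - \<phi> (k - 1)) \<le> \<alpha> k * p k"
      by (rule mult_left_mono) (auto simp: p_def \<alpha>)
    also have "\<dots> \<le> a * p k" by (intro mult_right_mono \<alpha> p_nonneg)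
    finally show ?thesis .
  qed
  have p_Suc: "p (Suc k) \<le> a * p k + \<delta> k" for k
    using rec[of k] \<alpha>p[of k] \<epsilon>[of k] \<delta>(1)[of k] mult_nonneg_nonneg[OF a(1) p_nonneg[of k]]
    by (simp add: p_def[of "Suc k"])
  have \<delta>_le: "sum \<delta> {..<n} \<le> suminf \<delta>" for n
    by (intro sum_le_suminf \<delta>) auto
  have "sum p {..<n} \<le> suminf \<delta> / (1 - a)" for n
  proof -
    \<comment> \<open>\<open>p 0 = 0\<close>, as \<open>0 - 1 = 0\<close> on the naturals, so the
      sum can be shifted to \<open>p (Suc k)\<close>. The resulting inequality is solved for the sum
      of \<open>p\<close> using \<open>a < 1\<close>.\<close>
    have "sum p {..<n} \<le> sum p {..<Suc n}" using p_nonneg[of n] by simp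
    also have "\<dots> = (\<Sum>k<n. p (Suc k))"
      by (subst sum.lessThan_Suc_shift) (simp add: p_def)
    also have "\<dots> \<le> (\<Sum>k<n. a * p k + \<delta> k)" by (intro sum_mono p_Suc)
    also have "\<dots> \<le> a * sum p {..<n} + suminf \<delta>"
      using \<delta>_le[of n] by (simp add: sum.distrib sum_distrib_left)
    finally show ?thesis using a by (simp add: field_simps)
  qed
  then have p_summable: "summable p"
    by (intro bounded_imp_summable[of p "suminf \<delta> / (1 - a)"] p_nonneg)
       (metis lessThan_Suc_atMost)
  have p_le: "sum p {..<n} \<le> suminf p" for n
    by (intro sum_le_suminf p_summable p_nonneg) auto

  \<comment> \<open>Removing the accumulated increases leaves a decreasing sequence; the range up to
    \<open>Suc n\<close> includes \<open>p n\<close>, the rise from \<open>n - 1\<close> to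
    \<open>n\<close>.\<close>
  let ?\<psi> = "\<lambda>n. \<phi> n - sum p {..<Suc n}"
  have "decseq ?\<psi>"
    by (rule decseq_SucI) (simp add: p_def)
  moreover have "- suminf p \<le> ?\<psi> n" for n
    using \<phi>[of n] p_le[of "Suc n"] by linarith
  ultimately obtain L where "?\<psi> \<longlonglongrightarrow> L" using decseq_convergent[of ?\<psi> "- suminf p"] by blast
  moreover have "(\<lambda>n. sum p {..<Suc n}) \<longlonglongrightarrow> suminf p"
    by (rule LIMSEQ_Suc[OF summable_LIMSEQ[OF p_summable]])
  ultimately have "(\<lambda>n. ?\<psi> n + sum p {..<Suc n}) \<longlonglongrightarrow> L + suminf p"
    by (rule tendsto_add)
  then show "convergent \<phi>" by (auto simp: convergent_def)

  have "sum \<epsilon> {..<n} \<le> a * suminf p + suminf \<delta> + \<phi> 0" for n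
  proof -
    have "sum \<epsilon> {..<n} \<le> (\<Sum>k<n. a * p k + \<delta> k - (\<phi> (Suc k) - \<phi> k))"
    proof (rule sum_mono)
      fix k show "\<epsilon> k \<le> a * p k + \<delta> k - (\<phi> (Suc k) - \<phi> k)"
        using rec[of k] \<alpha>p[of k] by linarith
    qed
    also have "\<dots> = a * sum p {..<n} + sum \<delta> {..<n} - (\<phi> n - \<phi> 0)"
      unfolding sum_subtractf[of _ "\<lambda>k. \<phi> (Suc k) - \<phi> k"] sum_lessThan_telescope
      by (simp add: sum.distrib sum_distrib_left)
    also have "\<dots> \<le> a * suminf p + suminf \<delta> + \<phi> 0"
      using mult_left_mono[OF p_le[of n] a(1)] \<delta>_le[of n] \<phi>[of n] by linarith
    finally show ?thesis .
  qed
  then show "summable \<epsilon>"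
    by (intro bounded_imp_summable[of \<epsilon> "a * suminf p + suminf \<delta> + \<phi> 0"] \<epsilon>)
       (metis lessThan_Suc_atMost)
qed

section \<open>Variational inequalities and the descent estimate\<close>

text \<open>Adding the two inequalities cancels \<theta>, and \<open>H\<close>-monotonicity bounds
  the remaining difference of \<open>F\<close>.\<close>

lemma mvi_two_points:
  assumes "mat_monotone H F" "sym_psd H"
    and "0 \<le> \<theta> x - \<theta> y + (x - y) \<bullet> (F y + g)"
    and "0 \<le> \<theta> y - \<theta> x + (y - x) \<bullet> (F x + h)"
  shows "inner_mat H (y - x) (y - x) + (y - x) \<bullet> (g - h) \<le> 0"
proof -
  have "inner_mat H (y - x) (y - x) \<le> (y - x) \<bullet> (F y - F x)"
    using assms(1,2) by (metis mat_monotone_def norm_mat_power2)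
  moreover have "0 \<le> (x - y) \<bullet> (F y + g) + (y - x) \<bullet> (F x + h)"
    using assms(3,4) by linarith
  ultimately show ?thesis by (simp add: inner_simps)
qed

text \<open>\<open>F\<close> may be discontinuous, so the inequality at \<open>y k\<close> need not
  pass to the limit. Comparing it with the one at the resolvent point \<open>p\<close> of
  \<open>l\<close> eliminates \<open>F\<close> and \<theta>; the limit of the remaining forms in
  \<open>G\<close> and \<open>H\<close> forces \<open>p = l\<close>.\<close>

lemma mvi_solutions_closed_under_residual_limits:
  assumes G: "sym_psd G" and H: "sym_psd H" "mat_monotone H F" and pd: "sym_pd (G + H)"
    and resolvent: "\<And>z. \<exists>p\<in>\<Omega>. \<forall>x\<in>\<Omega>. 0 \<le> \<theta> x - \<theta> p + (x - p) \<bullet> (F p + c *\<^sub>R (G *v (p - z)))"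
    and c: "0 < c"
    and y\<Omega>: "\<And>k. y k \<in> \<Omega>"
    and yvi: "\<And>k x. x \<in> \<Omega> \<Longrightarrow> 0 \<le> \<theta> x - \<theta> (y k) + (x - y k) \<bullet> (F (y k) + G *v e k)"
    and lim: "y \<longlonglongrightarrow> l" and e: "(\<lambda>k. inner_mat G (e k) (e k)) \<longlonglongrightarrow> 0"
  shows "l \<in> mvi_solutions \<Omega> \<theta> F"
proof -
  obtain p where p: "p \<in> \<Omega>"
    "\<And>x. x \<in> \<Omega> \<Longrightarrow> 0 \<le> \<theta> x - \<theta> p + (x - p) \<bullet> (F p + c *\<^sub>R (G *v (p - l)))"
    using resolvent[of l] by blast
  have bound: "inner_mat H (y k - p) (y k - p) + inner_mat G (y k - p) (e k)
      + c * inner_mat G (y k - p) (l - p) \<le> 0" for k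
  proof -
    have "G *v (p - l) = - (G *v (l - p))"
      by (simp add: matrix_vector_mult_diff_distrib)
    then show ?thesis
      using mvi_two_points[OF H(2,1) yvi[OF p(1), of k] p(2)[OF y\<Omega>]]
      by (simp add: inner_mat_def inner_add_right)
  qed
  \<comment> \<open>For singular \<open>G\<close> the vectors \<open>e k\<close> can be unbounded;
    Cauchy-Schwarz uses only their \<open>G\<close>-seminorm.\<close>
  have "(\<lambda>k. (inner_mat G (y k - p) (e k))\<^sup>2) \<longlonglongrightarrow> 0"
  proof (rule tendsto_sandwich[OF _ _ tendsto_const])
    have "(\<lambda>k. inner_mat G (y k - p) (y k - p) * inner_mat G (e k) (e k))
        \<longlonglongrightarrow> inner_mat G (l - p) (l - p) * 0"
      by (intro tendsto_mult tendsto_inner_mat tendsto_diff lim e tendsto_const)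
    then show "(\<lambda>k. inner_mat G (y k - p) (y k - p) * inner_mat G (e k) (e k)) \<longlonglongrightarrow> 0"
      by simp
  qed (simp_all add: inner_mat_Cauchy_Schwarz[OF G])
  then have cross: "(\<lambda>k. inner_mat G (y k - p) (e k)) \<longlonglongrightarrow> 0" by simp
  have "(\<lambda>k. inner_mat H (y k - p) (y k - p) + inner_mat G (y k - p) (e k)
      + c * inner_mat G (y k - p) (l - p))
    \<longlonglongrightarrow> inner_mat H (l - p) (l - p) + 0 + c * inner_mat G (l - p) (l - p)"
    by (intro tendsto_add tendsto_mult tendsto_inner_mat tendsto_diff lim cross tendsto_const)
  then have le: "inner_mat H (l - p) (l - p) + 0 + c * inner_mat G (l - p) (l - p) \<le> 0"
    by (rule tendsto_upperbound) (auto simp: bound)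
  \<comment> \<open>Nonnegative terms with nonpositive sum vanish, so both seminorms of
    \<open>l - p\<close> are 0.\<close>
  have nn: "0 \<le> inner_mat H (l - p) (l - p)" "0 \<le> inner_mat G (l - p) (l - p)"
    using G H by (auto intro: sym_psdD)
  have cG: "0 \<le> c * inner_mat G (l - p) (l - p)" using c nn by simp
  have "c * inner_mat G (l - p) (l - p) = 0" using le nn cG by linarith
  then have "inner_mat (G + H) (l - p) (l - p) \<le> 0"
    using le c by (simp add: inner_mat_add)
  then have "\<not> 0 < inner_mat (G + H) (l - p) (l - p)" by simp
  then have "l = p" using pd by (metis sym_pd_def inner_mat_def eq_iff_diff_eq_0)
  \<comment> \<open>With \<open>l = p\<close> the term \<open>G *v (p - l)\<close> vanishes, leaving
    the defining inequality of a solution.\<close>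
  then show ?thesis using p by (simp add: mvi_solutions_def)
qed

text \<open>Testing the step against \<open>x\<close> bounds the \<open>G\<close>-product of
  \<open>w (Suc k) - x\<close> with the residual \<open>r\<close>; the rest expands squares along
  \<open>w (Suc k) - x = u + \<alpha> k *\<^sub>R d + r\<close>.\<close>

lemma inertial_ppm_descent:
  assumes G: "sym_psd G" and H: "sym_psd H" "mat_monotone H F"
    and step: "inertial_ppm \<Omega> \<theta> F G \<alpha> lam w" and x: "x \<in> mvi_solutions \<Omega> \<theta> F"
    and \<alpha>: "0 \<le> \<alpha> k" "\<alpha> k \<le> 1" and lam: "0 < l" "l \<le> lam k"
  shows "inner_mat G (w (Suc k) - x) (w (Suc k) - x) - inner_mat G (w k - x) (w k - x)
    \<le> \<alpha> k * (inner_mat G (w k - x) (w k - x) - inner_mat G (w (k - 1) - x) (w (k - 1) - x))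
      + 2 * (\<alpha> k * inner_mat G (w k - w (k - 1)) (w k - w (k - 1)))
      - (inner_mat G (w (Suc k) - inertial_point \<alpha> w k) (w (Suc k) - inertial_point \<alpha> w k)
         + 2 * l * inner_mat H (w (Suc k) - x) (w (Suc k) - x))"
proof -
  define r where "r = w (Suc k) - inertial_point \<alpha> w k"
  define u where "u = w k - x"
  define d where "d = w k - w (k - 1)"
  define h where "h = inner_mat H (w (Suc k) - x) (w (Suc k) - x)"
  have h: "0 \<le> h" unfolding h_def using H by (auto intro: sym_psdD)
  have lk: "0 < lam k" using lam by linarith
  have "h + (w (Suc k) - x) \<bullet> (inverse (lam k) *\<^sub>R (G *v r) - 0) \<le> 0"
    unfolding h_def r_def
    by (rule mvi_two_points[OF H(2,1), where \<theta> = \<theta>])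
       (use step x in \<open>auto simp: inertial_ppm_def mvi_solutions_def\<close>)
  then have "lam k * (h + inverse (lam k) * inner_mat G (w (Suc k) - x) r) \<le> 0"
    using lk by (simp add: inner_mat_def mult_le_0_iff)
  then have "lam k * h + inner_mat G (w (Suc k) - x) r \<le> 0"
    using lk by (simp add: distrib_left flip: mult.assoc)
  moreover have "l * h \<le> lam k * h" using lam h by (intro mult_right_mono)
  moreover have wS: "w (Suc k) - x = u + \<alpha> k *\<^sub>R d + r"
    by (simp add: u_def d_def r_def inertial_point_def)
  ultimately have main: "l * h + inner_mat G (u + \<alpha> k *\<^sub>R d + r) r \<le> 0" by simp
  \<comment> \<open>The expansion gives the square of \<open>d\<close> the coefficient
    \<open>\<alpha> k + (\<alpha> k)\<^sup>2\<close>; this is the source of the factor 2.\<close>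
  have "(\<alpha> k)\<^sup>2 \<le> \<alpha> k" using \<alpha> by (simp add: power2_eq_square mult_left_le)
  then have sq: "(\<alpha> k)\<^sup>2 * inner_mat G d d \<le> \<alpha> k * inner_mat G d d"
    using sym_psdD(2)[OF G] by (intro mult_right_mono)
  have w1: "w (k - 1) - x = u - d" by (simp add: u_def d_def)
  have c: "inner_mat G d u = inner_mat G u d" "inner_mat G r u = inner_mat G u r"
    "inner_mat G d r = inner_mat G r d"
    by (rule inner_mat_commute[OF sym_psdD(1)[OF G]])+
  have "inner_mat G (u + \<alpha> k *\<^sub>R d + r) (u + \<alpha> k *\<^sub>R d + r) - inner_mat G u u
    \<le> \<alpha> k * (inner_mat G u u - inner_mat G (u - d) (u - d)) + 2 * (\<alpha> k * inner_mat G d d)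
      - (inner_mat G r r + 2 * l * h)"
    using main sq by (simp add: inner_mat_simps c power2_eq_square algebra_simps)
  then show ?thesis
    unfolding wS[symmetric] w1[symmetric] unfolding r_def u_def d_def h_def .
qed

section \<open>Convergence of the generated sequence\<close>

theorem theorem1:
  fixes \<Omega> :: "(real^'n) set"
    and \<theta> :: "real^'n \<Rightarrow> real"
    and F :: "real^'n \<Rightarrow> real^'n"
    and G H :: "real^'n^'n"
    and \<alpha> lam :: "nat \<Rightarrow> real"
    and \<alpha>_bar lam_low :: real
    and w :: "nat \<Rightarrow> real^'n"
  assumes "closed \<Omega>" and "convex \<Omega>"
    and "closed_proper_convex \<theta>"
    and "monotone_mapping F"
    and "sym_psd G"
    and "mvi_solutions \<Omega> \<theta> F \<noteq> {}"
    and "sym_psd H" and "mat_monotone H F"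
    and "sym_pd (G + H)"
    and "0 \<le> \<alpha>_bar" and "\<alpha>_bar < 1" and "\<And>k. 0 \<le> \<alpha> k \<and> \<alpha> k \<le> \<alpha>_bar"
    and "0 < lam_low" and "\<And>k. lam_low \<le> lam k"
    and "inertial_ppm_well_defined \<Omega> \<theta> F G \<alpha> lam"
    and "inertial_ppm \<Omega> \<theta> F G \<alpha> lam w"
    and "summable (\<lambda>k. \<alpha> (Suc k) * (norm_mat G (w (Suc k) - w k))\<^sup>2)"
  shows "\<exists>x \<in> mvi_solutions \<Omega> \<theta> F. w \<longlonglongrightarrow> x"
proof -
  note G = \<open>sym_psd G\<close> and H = \<open>sym_psd H\<close> \<open>mat_monotone H F\<close> and ppm = assms(16)
  let ?\<phi> = "\<lambda>x k. inner_mat G (w k - x) (w k - x)"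
  let ?h = "\<lambda>x k. inner_mat H (w k - x) (w k - x)"
  define r where "r k = w (Suc k) - inertial_point \<alpha> w k" for k
  have lam: "0 < lam k" for k using assms(13) assms(14)[of k] by linarith
  have \<alpha>_le_1: "\<alpha> k \<le> 1" for k using assms(11) assms(12)[of k] by linarith
  have \<delta>_nonneg: "0 \<le> 2 * (\<alpha> k * inner_mat G (w k - w (k - 1)) (w k - w (k - 1)))" for k
    using assms(12)[of k] sym_psdD(2)[OF G] by simp
  have \<delta>_summable: "summable (\<lambda>k. 2 * (\<alpha> k * inner_mat G (w k - w (k - 1)) (w k - w (k - 1))))"
    using assms(17) unfolding norm_mat_power2[OF G]
    by (subst summable_Suc_iff[symmetric]) (simp add: summable_mult)

  \<comment> \<open>Applied twice: at some solution \<open>x0\<close> for boundedness and vanishing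
    residuals, then at the cluster point \<open>y\<close>.\<close>
  have lims: "convergent (?\<phi> x)" "(\<lambda>k. inner_mat G (r k) (r k)) \<longlonglongrightarrow> 0" "?h x \<longlonglongrightarrow> 0"
    if x: "x \<in> mvi_solutions \<Omega> \<theta> F" for x
  proof -
    define \<epsilon> where "\<epsilon> k = inner_mat G (r k) (r k) + 2 * lam_low * ?h x (Suc k)" for k
    have parts: "0 \<le> inner_mat G (r k) (r k)" "0 \<le> 2 * lam_low * ?h x (Suc k)" for k
      using sym_psdD(2)[OF G] sym_psdD(2)[OF H(1)] assms(13) by auto
    have rec: "?\<phi> x (Suc k) - ?\<phi> x k \<le> \<alpha> k * (?\<phi> x k - ?\<phi> x (k - 1))
        + 2 * (\<alpha> k * inner_mat G (w k - w (k - 1)) (w k - w (k - 1))) - \<epsilon> k" for k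
      unfolding \<epsilon>_def r_def
      by (rule inertial_ppm_descent[OF G H ppm x _ \<alpha>_le_1 assms(13,14)]) (simp add: assms(12))
    note conv = inertial_recurrence_converges[OF rec _ _ assms(10,11) sym_psdD(2)[OF G]
        \<delta>_nonneg \<delta>_summable]
    show "convergent (?\<phi> x)"
      by (rule conv(1)) (use assms(12) parts in \<open>auto simp: \<epsilon>_def\<close>)
    have "summable \<epsilon>"
      by (rule conv(2)) (use assms(12) parts in \<open>auto simp: \<epsilon>_def\<close>)
    then have \<epsilon>: "\<epsilon> \<longlonglongrightarrow> 0" by (rule summable_LIMSEQ_zero)
    show "(\<lambda>k. inner_mat G (r k) (r k)) \<longlonglongrightarrow> 0"
      by (rule tendsto_sandwich[OF _ _ tendsto_const \<epsilon>]) (use parts in \<open>auto simp: \<epsilon>_def\<close>)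
    have "(\<lambda>k. 2 * lam_low * ?h x (Suc k)) \<longlonglongrightarrow> 0"
      by (rule tendsto_sandwich[OF _ _ tendsto_const \<epsilon>]) (use parts in \<open>auto simp: \<epsilon>_def\<close>)
    then have "(\<lambda>k. ?h x (Suc k)) \<longlonglongrightarrow> 0"
      using assms(13) by (simp add: tendsto_mult_left_iff)
    then show "?h x \<longlonglongrightarrow> 0" by (rule LIMSEQ_imp_Suc)
  qed

  obtain c where c: "0 < c" "\<And>v. c * (norm v)\<^sup>2 \<le> inner_mat (G + H) v v"
    using sym_pd_coercive[OF assms(9)] by blast
  have coercive: "(norm (w k - x))\<^sup>2 \<le> (?\<phi> x k + ?h x k) / c" for x k
    using c(1) c(2)[of "w k - x"] by (simp add: inner_mat_add field_simps)

  obtain x0 where x0: "x0 \<in> mvi_solutions \<Omega> \<theta> F" using assms(6) by blast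
  obtain L0 where "?\<phi> x0 \<longlonglongrightarrow> L0" using lims(1)[OF x0] by (auto simp: convergent_def)
  then have "(\<lambda>k. (?\<phi> x0 k + ?h x0 k) / c) \<longlonglongrightarrow> (L0 + 0) / c"
    using lims(3)[OF x0] c(1) by (intro tendsto_divide tendsto_add tendsto_const) auto
  then have "Bseq (\<lambda>k. (?\<phi> x0 k + ?h x0 k) / c)"
    by (rule convergent_imp_Bseq[OF convergentI])
  then obtain B where B: "\<And>k. norm ((?\<phi> x0 k + ?h x0 k) / c) \<le> B"
    by (rule BseqE) blast
  have "(norm (w k - x0))\<^sup>2 \<le> B" for k
    using coercive[of k x0] abs_ge_self B[of k] unfolding real_norm_def by (meson order_trans)
  then have "norm (w k - x0) \<le> sqrt B" for k by (simp add: real_le_rsqrt)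
  then have "bounded (range w)"
    by (auto simp: bounded_def dist_norm norm_minus_commute intro!: exI[of _ x0])
  \<comment> \<open>The index is shifted because \<open>w 0\<close> may lie outside \<Omega> and the
    residual \<open>r k\<close> belongs to \<open>w (Suc k)\<close>.\<close>
  then have "bounded (range (\<lambda>k. w (Suc k)))"
    by (rule bounded_subset) auto
  then obtain y s where s: "strict_mono s" "(\<lambda>j. w (Suc (s j))) \<longlonglongrightarrow> y"
    using bounded_imp_convergent_subsequence[of "\<lambda>k. w (Suc k)"] by (auto simp: o_def)

  have y: "y \<in> mvi_solutions \<Omega> \<theta> F"
  proof (rule mvi_solutions_closed_under_residual_limits[OF G H assms(9) _ _ _ _ s(2)])
    fix z
    \<comment> \<open>The inertial point of the first step is \<open>z\<close> itself, so
      \<open>v (Suc 0)\<close> is a resolvent point of \<open>z\<close> with constant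
      \<open>inverse (lam 0)\<close>.\<close>
    obtain v where "v 0 = z" "inertial_ppm \<Omega> \<theta> F G \<alpha> lam v"
      using assms(15) unfolding inertial_ppm_well_defined_def by blast
    then show "\<exists>p\<in>\<Omega>. \<forall>x\<in>\<Omega>. 0 \<le> \<theta> x - \<theta> p
        + (x - p) \<bullet> (F p + inverse (lam 0) *\<^sub>R (G *v (p - z)))"
      unfolding inertial_ppm_def
      by (intro bexI[of _ "v (Suc 0)"]) (auto simp: inertial_point_def dest: spec[of _ 0])
    show "0 < inverse (lam 0)" using lam by simp
    show "w (Suc (s k)) \<in> \<Omega>" for k using ppm by (simp add: inertial_ppm_def)
    show "0 \<le> \<theta> x - \<theta> (w (Suc (s k))) + (x - w (Suc (s k)))
        \<bullet> (F (w (Suc (s k))) + G *v (inverse (lam (s k)) *\<^sub>R r (s k)))" if "x \<in> \<Omega>" for k x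
      using ppm that by (simp add: inertial_ppm_def r_def matrix_vector_mult_scaleR)
    show "(\<lambda>k. inner_mat G (inverse (lam (s k)) *\<^sub>R r (s k)) (inverse (lam (s k)) *\<^sub>R r (s k))) \<longlonglongrightarrow> 0"
    \<comment> \<open>The positive lower bound on \<open>lam\<close> keeps the factors
      \<open>inverse (lam (s k))\<close> bounded.\<close>
    proof (rule tendsto_sandwich[OF _ _ tendsto_const])
      have "(\<lambda>k. inner_mat G (r (s k)) (r (s k))) \<longlonglongrightarrow> 0"
        using LIMSEQ_subseq_LIMSEQ[OF lims(2)[OF x0] s(1)] by (simp add: o_def)
      then show "(\<lambda>k. (inverse lam_low)\<^sup>2 * inner_mat G (r (s k)) (r (s k))) \<longlonglongrightarrow> 0"
        by (rule tendsto_mult_right_zero)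
      have "(inverse (lam (s k)))\<^sup>2 \<le> (inverse lam_low)\<^sup>2" for k
        using assms(13,14) lam[of "s k"] by (intro power_mono le_imp_inverse_le) auto
      then show "\<forall>\<^sub>F k in sequentially.
          inner_mat G (inverse (lam (s k)) *\<^sub>R r (s k)) (inverse (lam (s k)) *\<^sub>R r (s k))
          \<le> (inverse lam_low)\<^sup>2 * inner_mat G (r (s k)) (r (s k))"
        by (auto intro!: always_eventually mult_right_mono sym_psdD(2)[OF G]
            simp: inner_mat_simps power2_eq_square mult.assoc[symmetric] simp del: inverse_mult_distrib)
    qed (simp_all add: sym_psdD(2)[OF G])
  qed

  \<comment> \<open>The whole sequence \<open>?\<phi> y\<close> converges, so its limit can be read
    off from the subsequence.\<close>
  have "(\<lambda>j. ?\<phi> y (Suc (s j))) \<longlonglongrightarrow> inner_mat G (y - y) (y - y)"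
    by (intro tendsto_inner_mat tendsto_diff s tendsto_const)
  then have sub: "(\<lambda>j. ?\<phi> y (Suc (s j))) \<longlonglongrightarrow> 0" by (simp add: inner_mat_def)
  obtain L where L: "?\<phi> y \<longlonglongrightarrow> L" using lims(1)[OF y] by (auto simp: convergent_def)
  have "strict_mono (\<lambda>j. Suc (s j))" using s(1) by (simp add: strict_mono_def)
  from LIMSEQ_subseq_LIMSEQ[OF L this] sub have "L = 0"
    by (intro LIMSEQ_unique[of "\<lambda>j. ?\<phi> y (Suc (s j))"]) (auto simp: o_def)
  then have "(\<lambda>k. (?\<phi> y k + ?h y k) / c) \<longlonglongrightarrow> (0 + 0) / c"
    using L lims(3)[OF y] c(1) by (intro tendsto_divide tendsto_add tendsto_const) auto
  then have upper: "(\<lambda>k. (?\<phi> y k + ?h y k) / c) \<longlonglongrightarrow> 0" by simp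
  have "(\<lambda>k. (norm (w k - y))\<^sup>2) \<longlonglongrightarrow> 0"
    by (rule tendsto_sandwich[OF _ _ tendsto_const upper]) (simp_all add: coercive)
  then have "(\<lambda>k. w k - y) \<longlonglongrightarrow> 0" by (simp add: tendsto_norm_zero_iff)
  then have "w \<longlonglongrightarrow> y" by (simp add: LIM_zero_iff)
  with y show ?thesis by blast
qed

end
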